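(* Let $n\ge 4$ be an integer, and let $(\mathcal{A},\mathcal{B})$ be a $(2,n)$-bounded 1-cross intersecting set pair system of size $m$. Then $$m\le \left(\left\lfloor\frac{n}{2}\right\rfloor+1\right)\left(\left\lceil\frac{n}{2}\right\rceil+1\right).$$ This bound is the best possible, i.e., for every $n\ge 4$ there exists a $(2,n)$-bounded 1-cross intersecting set pair system whose size equals the right-hand side. For $n=2$ and $n=3$, the maximum size of a $(2,n)$-bounded 1-cross intersecting set pair system is $5$ and $7$, respectively.
   Context: A cross intersecting set pair system (SPS) of size $m\ge 2$ consists of finite sets $A_1,\dots,A_m$ and $B_1,\dots,B_m$ such that $A_i\cap B_i=\emptyset$ for every $1\le i\le m$ and $A_i\cap B_j\neq\emptyset$ for all $1\le i\neq j\le m$; one writes $\mathcal{A}=\{A_i\}_{i=1}^m$, $\mathcal{B}=\{B_i\}_{i=1}^m$. It is $(a,b)$-bounded if $|A_i|\le a$ and $|B_i|\le b$ for each $i$. It is 1-cross intersecting if $|A_i\cap B_j|=1$ for each $i\neq j$. *)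

theory Defs
  imports Complex_Main
begin

text \<open>
  The families are functions on \<open>nat\<close> of which only the values at \<open>1, \<dots>, m\<close> matter;
  the number \<open>m\<close> is the size of the system.
\<close>

definition cross_intersecting_SPS :: "nat \<Rightarrow> (nat \<Rightarrow> 'a set) \<Rightarrow> (nat \<Rightarrow> 'a set) \<Rightarrow> bool" where
  "cross_intersecting_SPS m A B \<longleftrightarrow>
     2 \<le> m \<and>
     (\<forall>i\<in>{1..m}. finite (A i) \<and> finite (B i)) \<and>
     (\<forall>i\<in>{1..m}. A i \<inter> B i = {}) \<and>
     (\<forall>i\<in>{1..m}. \<forall>j\<in>{1..m}. i \<noteq> j \<longrightarrow> A i \<inter> B j \<noteq> {})"

definition bounded_SPS ::
  "nat \<Rightarrow> nat \<Rightarrow> nat \<Rightarrow> (nat \<Rightarrow> 'a set) \<Rightarrow> (nat \<Rightarrow> 'a set) \<Rightarrow> bool" where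
  "bounded_SPS a b m A B \<longleftrightarrow> (\<forall>i\<in>{1..m}. card (A i) \<le> a \<and> card (B i) \<le> b)"

definition one_cross_intersecting :: "nat \<Rightarrow> (nat \<Rightarrow> 'a set) \<Rightarrow> (nat \<Rightarrow> 'a set) \<Rightarrow> bool" where
  "one_cross_intersecting m A B \<longleftrightarrow>
     (\<forall>i\<in>{1..m}. \<forall>j\<in>{1..m}. i \<noteq> j \<longrightarrow> card (A i \<inter> B j) = 1)"

definition bounded_one_cross_SPS ::
  "nat \<Rightarrow> nat \<Rightarrow> nat \<Rightarrow> (nat \<Rightarrow> 'a set) \<Rightarrow> (nat \<Rightarrow> 'a set) \<Rightarrow> bool" where
  "bounded_one_cross_SPS a b m A B \<longleftrightarrow>
     cross_intersecting_SPS m A B \<and> bounded_SPS a b m A B \<and> one_cross_intersecting m A B"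

end

theory Submission
  imports Defs
begin

text \<open>
  Read the sets \<open>A i\<close> as the edges of a graph; a singleton \<open>A i\<close> becomes an edge after adding a
  private new vertex, which lies in no \<open>B j\<close>.  Then \<open>B i\<close> avoids both ends of the edge \<open>i\<close> and
  contains exactly one end of every other edge.  Call a vertex set an exact cover if it contains
  exactly one end of every edge, that is, if it is one side of a 2-colouring.

  If there is no exact cover, no three edges \<open>e\<close>, \<open>f\<close>, \<open>g\<close> share a vertex, because the vertices
  lying in at least two of \<open>B e\<close>, \<open>B f\<close>, \<open>B g\<close> would form one.  So every degree is at most 2, and
  the at most \<open>n\<close> vertices of a single \<open>B e\<close> cover all other edges: there are at most \<open>2 n + 1\<close>
  edges.  (The graph is in fact an odd cycle.)

  If \<open>P\<close> is an exact cover, the symmetric difference of \<open>P\<close> and \<open>B i\<close> is a cut crossed by the edge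
  \<open>i\<close> alone.  Thus every edge is a bridge and the graph is a forest.  Let \<open>M\<close> be an exact cover of
  minimum size \<open>S\<close>, and let a component \<open>C\<close> have \<open>a\<close> vertices inside and \<open>b\<close> outside \<open>M\<close>; by
  minimality \<open>a \<le> b\<close>.  Counting edges gives a leaf of \<open>C\<close> outside \<open>M\<close>.  If \<open>i\<close> is the edge at this
  leaf, \<open>B i\<close> contains all the other \<open>b - 1\<close> vertices of \<open>C\<close> outside \<open>M\<close>, and at least \<open>S - a\<close>
  vertices outside \<open>C\<close>, since it covers the rest of the graph exactly.  Hence
  \<open>b - 1 + S - a \<le> n\<close>, the content of \<open>card_component_Diff_le\<close>.

  For \<open>S \<le> n\<close> this bounds the \<open>a + b - 1\<close> edges of \<open>C\<close> by \<open>a (n + 2 - S)\<close>.  Summing over the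
  components gives at most \<open>S (n + 2 - S)\<close> edges, a product of two factors with sum \<open>n + 2\<close>, and it
  is largest when the factors are as equal as possible.  For \<open>S > n\<close> it forces \<open>S = n + 1\<close> and \<open>a = b\<close>
  in every component, so the forest has \<open>2 n + 2\<close> vertices and at most \<open>2 n + 1\<close> edges.

  Both values are attained: the product by \<open>\<lfloor>n / 2\<rfloor> + 1\<close> disjoint stars with \<open>\<lceil>n / 2\<rceil> + 1\<close> edges
  each, and \<open>2 n + 1\<close> by the odd cycle of that length.  For \<open>n \<ge> 2\<close>, the
  cycle is larger exactly when \<open>n\<close> is 2 or 3.
\<close>

section \<open>Comparing the sizes of stars and cycles\<close>

lemma mult_le_balanced_mult:
  fixes s n :: nat
  assumes "s \<le> n + 2"
  shows "s * (n + 2 - s) \<le> (n div 2 + 1) * ((n + 1) div 2 + 1)"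
proof -
  define p q where "p = int (n div 2 + 1)" and "q = int ((n + 1) div 2 + 1)"
  have pq: "p + q = int n + 2" "p \<le> q" "q \<le> p + 1" unfolding p_def q_def by linarith+
  \<comment> \<open>No integer lies strictly between \<open>p\<close> and \<open>q\<close>, so the two factors never have opposite signs.\<close>
  have "0 \<le> (int s - p) * (int s - q)"
    using pq by (cases "int s \<le> p") (auto intro: mult_nonpos_nonpos mult_nonneg_nonneg)
  then have "int s * (p + q - int s) \<le> p * q" by (simp add: algebra_simps)
  then have "int (s * (n + 2 - s)) \<le> int ((n div 2 + 1) * ((n + 1) div 2 + 1))"
    using assms pq unfolding of_nat_mult p_def[symmetric] q_def[symmetric]
    by (simp add: of_nat_diff add.commute)
  then show ?thesis by (simp only: of_nat_le_iff)
qed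

lemma odd_cycle_le_stars:
  fixes n :: nat
  assumes "4 \<le> n"
  shows "2 * n + 1 \<le> (n div 2 + 1) * ((n + 1) div 2 + 1)"
proof (cases "even n")
  case True
  then obtain k where k: "n = 2 * k" by blast
  then have "2 * k \<le> k * k" using assms by simp
  with k show ?thesis by (simp add: algebra_simps)
next
  case False
  then obtain k where k: "n = 2 * k + 1" by (blast elim: oddE)
  then have "2 * k \<le> k * k" using assms by simp
  moreover have "k + 1 \<le> 2 * k" using k assms by simp
  ultimately have "k + 1 \<le> k * k" by (rule order_trans[rotated])
  with k show ?thesis by (simp add: algebra_simps)
qed

section \<open>Graphs all of whose edges can be missed by a cover\<close>

text \<open>
  Singletons \<open>A i\<close> are excluded because a forest with such half-edges can have as many edges as
  vertices; padding them with a new vertex restores the strict inequality.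
\<close>

locale edge_missing_covers =
  fixes I :: "'i set" and A B :: "'i \<Rightarrow> 'v set" and n :: nat
  assumes finite_I: "finite I"
    and edge: "i \<in> I \<Longrightarrow> card (A i) = 2"
    and missed: "i \<in> I \<Longrightarrow> A i \<inter> B i = {}"
    and met: "i \<in> I \<Longrightarrow> j \<in> I \<Longrightarrow> i \<noteq> j \<Longrightarrow> card (A i \<inter> B j) = 1"
    and finite_B: "i \<in> I \<Longrightarrow> finite (B i)"
    and card_B: "i \<in> I \<Longrightarrow> card (B i) \<le> n"
begin

definition exact_cover :: "'v set \<Rightarrow> bool" where
  "exact_cover X \<longleftrightarrow> (\<forall>i\<in>I. card (A i \<inter> X) = 1)"

definition union_of_components :: "'v set \<Rightarrow> bool" where
  "union_of_components W \<longleftrightarrow> (\<forall>i\<in>I. A i \<subseteq> W \<or> A i \<inter> W = {})"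

definition V :: "'v set" where
  "V = (\<Union>i\<in>I. A i)"

definition edges_within :: "'v set \<Rightarrow> 'i set" where
  "edges_within U = {i\<in>I. A i \<subseteq> U}"

text \<open>
  Connectedness is expressed through minimality instead of paths: this makes it immediate that two
  exact covers agree or are complementary on a component, because the points where they differ
  form a union of components.
\<close>

definition component :: "'v set \<Rightarrow> bool" where
  "component C \<longleftrightarrow> C \<noteq> {} \<and> C \<subseteq> V \<and> union_of_components C \<and>
     (\<forall>W\<subseteq>C. union_of_components W \<longrightarrow> W = {} \<or> W = C)"

lemma edgeE:
  assumes "i \<in> I"
  obtains x y where "A i = {x, y}" "x \<noteq> y"
  using edge[OF assms] by (auto simp: card_2_iff)

lemma card_pair_Int_eq_1_iff:
  assumes "x \<noteq> y"
  shows "card ({x, y} \<inter> X) = 1 \<longleftrightarrow> (x \<in> X) \<noteq> (y \<in> X)"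
  using assms by (cases "x \<in> X"; cases "y \<in> X") auto

lemma finite_A: "i \<in> I \<Longrightarrow> finite (A i)"
  using edge by (metis card.infinite zero_neq_numeral)

lemma finite_V: "finite V"
  unfolding V_def using finite_I finite_A by auto

lemma finite_edges_within: "finite (edges_within U)"
  unfolding edges_within_def using finite_I by auto

lemma exact_coverD: "exact_cover X \<Longrightarrow> i \<in> I \<Longrightarrow> A i = {x, y} \<Longrightarrow> x \<noteq> y \<Longrightarrow> (x \<in> X) \<noteq> (y \<in> X)"
  unfolding exact_cover_def using card_pair_Int_eq_1_iff by metis

lemma exact_coverI:
  assumes "\<And>i x y. i \<in> I \<Longrightarrow> A i = {x, y} \<Longrightarrow> x \<noteq> y \<Longrightarrow> (x \<in> X) \<noteq> (y \<in> X)"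
  shows "exact_cover X"
  unfolding exact_cover_def
proof
  fix i assume i: "i \<in> I"
  then obtain x y where "A i = {x, y}" "x \<noteq> y" by (rule edgeE)
  with assms[OF i this] show "card (A i \<inter> X) = 1"
    using card_pair_Int_eq_1_iff by metis
qed

lemma metD:
  "i \<in> I \<Longrightarrow> j \<in> I \<Longrightarrow> i \<noteq> j \<Longrightarrow> A i = {x, y} \<Longrightarrow> x \<noteq> y \<Longrightarrow> (x \<in> B j) \<noteq> (y \<in> B j)"
  using met card_pair_Int_eq_1_iff by metis

lemma union_of_componentsI:
  assumes "\<And>i x y. i \<in> I \<Longrightarrow> A i = {x, y} \<Longrightarrow> x \<noteq> y \<Longrightarrow> (x \<in> W) = (y \<in> W)"
  shows "union_of_components W"
  unfolding union_of_components_def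
proof
  fix i assume i: "i \<in> I"
  then obtain x y where "A i = {x, y}" "x \<noteq> y" by (rule edgeE)
  with assms[OF i this] show "A i \<subseteq> W \<or> A i \<inter> W = {}" by auto
qed

lemma union_of_componentsD:
  "union_of_components W \<Longrightarrow> i \<in> I \<Longrightarrow> A i = {x, y} \<Longrightarrow> (x \<in> W) = (y \<in> W)"
  unfolding union_of_components_def by fastforce

lemma union_of_components_Diff:
  assumes "union_of_components W" "union_of_components C"
  shows "union_of_components (W - C)"
  by (rule union_of_componentsI) (use assms union_of_componentsD in blast)

section \<open>Graphs without an exact cover\<close>

text \<open>
  Let \<open>e\<close>, \<open>f\<close>, \<open>g\<close> share the vertex \<open>x\<close>.  The vertices in at least two of \<open>B e\<close>, \<open>B f\<close>, \<open>B g\<close>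
  form an exact cover.  At an edge other than these three, membership in each of the sets flips
  from one end to the other, and so does the majority.  Now consider \<open>e\<close>; the edges \<open>f\<close> and \<open>g\<close>
  are alike.  Its end \<open>x\<close> lies in none of the sets, so its other end lies in both \<open>B f\<close> and \<open>B g\<close>.
\<close>

lemma degree_le_2_if_no_exact_cover:
  assumes none: "\<nexists>X. exact_cover X"
  shows "card {i\<in>I. x \<in> A i} \<le> 2"
proof (rule ccontr)
  assume "\<not> ?thesis"
  then have "3 \<le> card {i\<in>I. x \<in> A i}" by simp
  then obtain T where T: "T \<subseteq> {i\<in>I. x \<in> A i}" "card T = 3"
    by (metis obtain_subset_with_card_n)
  then obtain e f g where "T = {e, f, g}" and ne: "e \<noteq> f" "e \<noteq> g" "f \<noteq> g"
    by (auto simp: card_3_iff)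
  with T have I: "e \<in> I" "f \<in> I" "g \<in> I" and x: "x \<in> A e" "x \<in> A f" "x \<in> A g" by auto
  have xB: "x \<notin> B e" "x \<notin> B f" "x \<notin> B g" using missed I x by blast+
  define X where "X = (B e \<inter> B f) \<union> (B f \<inter> B g) \<union> (B e \<inter> B g)"
  have "exact_cover X"
  proof (rule exact_coverI)
    fix i y z assume i: "i \<in> I" "A i = {y, z}" "y \<noteq> z"
    have e: "i \<noteq> e \<Longrightarrow> (y \<in> B e) \<noteq> (z \<in> B e)" using metD i I by blast
    have f: "i \<noteq> f \<Longrightarrow> (y \<in> B f) \<noteq> (z \<in> B f)" using metD i I by blast
    have g: "i \<noteq> g \<Longrightarrow> (y \<in> B g) \<noteq> (z \<in> B g)" using metD i I by blast
    consider "i \<noteq> e \<and> i \<noteq> f \<and> i \<noteq> g" | "(i = e \<or> i = f \<or> i = g) \<and> x = y"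
      | "(i = e \<or> i = f \<or> i = g) \<and> x = z"
      using x i by blast
    then show "(y \<in> X) \<noteq> (z \<in> X)"
    proof cases
      case 1 then show ?thesis using e f g unfolding X_def by blast
    next
      case 2 then show ?thesis using e f g ne xB missed[OF i(1)] i unfolding X_def by auto
    next
      case 3 then show ?thesis using e f g ne xB missed[OF i(1)] i unfolding X_def by auto
    qed
  qed
  with none show False by blast
qed

lemma card_le_if_no_exact_cover:
  assumes none: "\<nexists>X. exact_cover X"
  shows "card I \<le> 2 * n + 1"
proof (cases "I = {}")
  case False
  then obtain e where e: "e \<in> I" by blast
  have sub: "I - {e} \<subseteq> (\<Union>x\<in>B e. {i\<in>I. x \<in> A i})"
  proof
    fix i assume "i \<in> I - {e}"
    moreover from this have "A i \<inter> B e \<noteq> {}" using met[of i e] e by auto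
    ultimately show "i \<in> (\<Union>x\<in>B e. {i\<in>I. x \<in> A i})" by blast
  qed
  have "card (I - {e}) \<le> card (\<Union>x\<in>B e. {i\<in>I. x \<in> A i})"
    by (rule card_mono[OF _ sub]) (use finite_I finite_B[OF e] in auto)
  also have "\<dots> \<le> (\<Sum>x\<in>B e. card {i\<in>I. x \<in> A i})"
    by (rule card_UN_le[OF finite_B[OF e]])
  also have "\<dots> \<le> (\<Sum>x\<in>B e. 2)"
    by (rule sum_mono) (rule degree_le_2_if_no_exact_cover[OF none])
  also have "\<dots> \<le> 2 * n" using card_B[OF e] by simp
  finally show ?thesis using e finite_I by (simp add: card_Diff_singleton)
qed simp

section \<open>Graphs with an exact cover are forests\<close>

text \<open>
  A forest has fewer edges than vertices.  The cut \<open>D\<close> below is crossed by the edge \<open>i\<close> only, so it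
  splits \<open>U\<close> into two smaller nonempty parts, and induction applies to both.
\<close>

lemma card_edges_within_less:
  assumes P: "exact_cover P" and "finite U" "U \<noteq> {}"
  shows "card (edges_within U) < card U"
  using assms(2,3)
proof (induction "card U" arbitrary: U rule: less_induct)
  case less
  show ?case
  proof (cases "edges_within U = {}")
    case True
    then show ?thesis using less.prems by (simp add: card_gt_0_iff)
  next
    case False
    then obtain i where i: "i \<in> I" "A i \<subseteq> U" unfolding edges_within_def by blast
    define D where "D = (P - B i) \<union> (B i - P)"
    define U1 U2 where "U1 = U \<inter> D" and "U2 = U - D"
    obtain x y where xy: "A i = {x, y}" "x \<noteq> y" using edgeE i by blast
    have "(x \<in> D) \<noteq> (y \<in> D)"
      using exact_coverD[OF P i(1) xy] missed[OF i(1)] xy unfolding D_def by auto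
    then have ne: "U1 \<noteq> {}" "U2 \<noteq> {}" using i xy unfolding U1_def U2_def by auto
    have U: "U = U1 \<union> U2" "U1 \<inter> U2 = {}" "finite U1" "finite U2"
      using less.prems unfolding U1_def U2_def by auto
    then have card_U: "card U = card U1 + card U2" using card_Un_disjoint by metis
    have smaller: "card U1 < card U" "card U2 < card U"
      using card_U ne U by (auto simp: card_gt_0_iff)
    have "edges_within U \<subseteq> insert i (edges_within U1 \<union> edges_within U2)"
    proof
      fix j assume "j \<in> edges_within U"
      then have j: "j \<in> I" "A j \<subseteq> U" unfolding edges_within_def by auto
      obtain u v where uv: "A j = {u, v}" "u \<noteq> v" using edgeE j by blast
      show "j \<in> insert i (edges_within U1 \<union> edges_within U2)"
      proof (cases "j = i")
        case False
        then have "(u \<in> D) = (v \<in> D)"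
          using exact_coverD[OF P j(1) uv] metD[OF j(1) i(1) False uv] unfolding D_def by auto
        then show ?thesis using j uv unfolding edges_within_def U1_def U2_def by auto
      qed simp
    qed
    then have "card (edges_within U) \<le> card (insert i (edges_within U1 \<union> edges_within U2))"
      by (rule card_mono[rotated]) (simp add: finite_edges_within)
    also have "\<dots> \<le> Suc (card (edges_within U1 \<union> edges_within U2))"
      by (rule card_insert_le_m1) auto
    also have "\<dots> \<le> Suc (card (edges_within U1) + card (edges_within U2))"
      using card_Un_le by blast
    finally show ?thesis
      using less.hyps[OF smaller(1) U(3) ne(1)] less.hyps[OF smaller(2) U(4) ne(2)] card_U by simp
  qed
qed

text \<open>
  Splitting off one component at a time replaces sums over the set of all components.  Each step
  removes a nonempty union of components of smallest size.
\<close>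

lemma union_of_components_induct [consumes 2, case_names empty insert]:
  assumes "union_of_components W" "W \<subseteq> V" "P {}"
    and step: "\<And>C W. component C \<Longrightarrow> W \<subseteq> V \<Longrightarrow> C \<inter> W = {} \<Longrightarrow> P W \<Longrightarrow> P (C \<union> W)"
  shows "P W"
  using assms(1,2)
proof (induction "card W" arbitrary: W rule: less_induct)
  case less
  show ?case
  proof (cases "W = {}")
    case False
    define Q where "Q C \<longleftrightarrow> C \<noteq> {} \<and> C \<subseteq> W \<and> union_of_components C" for C
    have finW: "finite W" using less.prems finite_V finite_subset by blast
    have "Q W" using False less.prems unfolding Q_def by blast
    then obtain C where C: "Q C" and min: "\<And>C'. Q C' \<Longrightarrow> card C \<le> card C'"
      using ex_has_least_nat[of Q W card] by blast
    have finC: "finite C" using C finW finite_subset unfolding Q_def by blast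
    have "component C"
      unfolding component_def
    proof (intro conjI allI impI)
      fix C' assume C': "C' \<subseteq> C" "union_of_components C'"
      show "C' = {} \<or> C' = C"
      proof (rule disjCI)
        assume "C' \<noteq> C"
        then have "card C' < card C" using C' finC by (meson psubsetI psubset_card_mono)
        then show "C' = {}" using min[of C'] C C' unfolding Q_def by auto
      qed
    qed (use C less.prems in \<open>auto simp: Q_def\<close>)
    moreover have "P (W - C)"
    proof (rule less.hyps)
      show "card (W - C) < card W"
        using C finW unfolding Q_def by (intro psubset_card_mono) auto
      show "union_of_components (W - C)"
        using C less.prems union_of_components_Diff unfolding Q_def by blast
    qed (use less.prems in auto)
    ultimately have "P (C \<union> (W - C))" using less.prems by (intro step) auto
    moreover have "C \<union> (W - C) = W" using C unfolding Q_def by blast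
    ultimately show ?thesis by simp
  qed (use assms(3) in simp)
qed

lemma finite_component: "component C \<Longrightarrow> finite C"
  using finite_subset[OF _ finite_V] unfolding component_def by simp

section \<open>Minimum exact covers\<close>

context
  fixes M
  assumes exact_M: "exact_cover M" and M_sub: "M \<subseteq> V"
    and M_min: "\<And>X. exact_cover X \<Longrightarrow> X \<subseteq> V \<Longrightarrow> card M \<le> card X"
begin

lemma finite_M: "finite M"
  using M_sub finite_V finite_subset by blast

text \<open>
  Exchanging the two sides of \<open>M\<close> inside \<open>C\<close> gives another exact cover, which is not smaller.
\<close>

lemma card_component_Int_le:
  assumes C: "component C"
  shows "card (C \<inter> M) \<le> card (C - M)"
proof -
  have CV: "C \<subseteq> V" "union_of_components C" "finite C"
    using C finite_V finite_subset unfolding component_def by blast+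
  define X where "X = (M - C) \<union> (C - M)"
  have "exact_cover X"
    by (rule exact_coverI) (use exact_coverD[OF exact_M] union_of_componentsD[OF CV(2)] in \<open>unfold X_def, blast\<close>)
  then have "card M \<le> card X" using M_min M_sub CV unfolding X_def by blast
  moreover have "card X = card (M - C) + card (C - M)"
    unfolding X_def using finite_M CV by (intro card_Un_disjoint) auto
  moreover have "card M = card (M - C) + card (C \<inter> M)"
    using card_Un_disjoint[of "M - C" "C \<inter> M"] finite_M CV
    by (metis Diff_disjoint Int_Diff_Un Int_commute Int_Diff Un_commute finite_Diff finite_Int)
  ultimately show ?thesis by simp
qed

text \<open>
  Every edge within \<open>C\<close> has exactly one end in \<open>C - M\<close>.  If all degrees there were at least 2, there
  would be at least \<open>2 * card (C - M)\<close> such edges.  But \<open>C - M\<close> makes up at least half of \<open>C\<close>, and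
  the forest has fewer edges than vertices within \<open>C\<close>.
\<close>

lemma component_has_leaf_outside:
  assumes C: "component C"
  obtains v i where "v \<in> C - M" "i \<in> I" "{j\<in>I. v \<in> A j} = {i}"
proof -
  have CV: "C \<noteq> {}" "C \<subseteq> V" "union_of_components C" "finite C"
    using C finite_V finite_subset unfolding component_def by blast+
  have "\<exists>v\<in>C - M. card {j\<in>I. v \<in> A j} \<le> 1"
  proof (rule ccontr)
    assume "\<not> ?thesis"
    then have "(\<Sum>v\<in>C - M. 2) \<le> (\<Sum>v\<in>C - M. card {j\<in>I. v \<in> A j})"
      by (intro sum_mono) (simp add: not_le Suc_le_eq numeral_2_eq_2)
    also have "\<dots> = card (\<Union>v\<in>C - M. {j\<in>I. v \<in> A j})"
    proof (rule card_UN_disjoint[symmetric])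
      show "\<forall>u\<in>C - M. \<forall>v\<in>C - M. u \<noteq> v \<longrightarrow> {j\<in>I. u \<in> A j} \<inter> {j\<in>I. v \<in> A j} = {}"
      proof (intro ballI impI)
        fix u v assume uv: "u \<in> C - M" "v \<in> C - M" "u \<noteq> v"
        have False if j: "j \<in> I" "u \<in> A j" "v \<in> A j" for j
        proof -
          obtain x y where xy: "A j = {x, y}" "x \<noteq> y" using edgeE j by blast
          from exact_coverD[OF exact_M j(1) xy] show False using uv j xy by auto
        qed
        then show "{j\<in>I. u \<in> A j} \<inter> {j\<in>I. v \<in> A j} = {}" by blast
      qed
    qed (use CV finite_I in auto)
    also have "\<dots> \<le> card (edges_within C)"
    proof (rule card_mono[OF finite_edges_within])
      show "(\<Union>v\<in>C - M. {j\<in>I. v \<in> A j}) \<subseteq> edges_within C"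
        using CV(3) unfolding union_of_components_def edges_within_def by blast
    qed
    also have "\<dots> < card C" by (rule card_edges_within_less[OF exact_M CV(4,1)])
    also have "card C = card (C \<inter> M) + card (C - M)" by (rule card_Int_Diff[OF CV(4)])
    finally show False using card_component_Int_le[OF C] by simp
  qed
  then obtain v where v: "v \<in> C - M" "card {j\<in>I. v \<in> A j} \<le> 1" by blast
  obtain i where i: "i \<in> I" "v \<in> A i" using v CV unfolding V_def by blast
  have "{j\<in>I. v \<in> A j} = {i}"
    using card_le_Suc0_iff_eq[of "{j\<in>I. v \<in> A j}"] v(2) i finite_I by auto
  with v i show thesis using that by blast
qed

text \<open>
  Apply \<open>card (B i) \<le> n\<close> to the edge \<open>i\<close> at a leaf \<open>v\<close> of \<open>C\<close> outside \<open>M\<close>.  Adding \<open>v\<close> to \<open>B i\<close>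
  makes it an exact cover, which shares \<open>v\<close> with the complement of \<open>M\<close> and hence contains all of
  \<open>C - M\<close>.  The part of \<open>B i\<close> outside \<open>C\<close> together with \<open>C \<inter> M\<close> contains an exact cover within
  \<open>V\<close>, so it has at least \<open>card M\<close> elements.
\<close>

lemma card_component_Diff_le:
  assumes C: "component C"
  shows "card (C - M) + card M \<le> n + 1 + card (C \<inter> M)"
proof -
  have CV: "C \<noteq> {}" "C \<subseteq> V" "union_of_components C" "finite C"
    using C finite_V finite_subset unfolding component_def by blast+
  obtain v i where v: "v \<in> C - M" and i: "i \<in> I" and leaf: "{j\<in>I. v \<in> A j} = {i}"
    using component_has_leaf_outside[OF C] by blast
  \<comment> \<open>The points of \<open>C\<close> where the exact covers \<open>insert v (B i)\<close> and \<open>M\<close> differ.\<close>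
  define D where "D = C \<inter> ((insert v (B i) - M) \<union> (M - insert v (B i)))"
  have "union_of_components D"
  proof (rule union_of_componentsI)
    fix j x y assume j: "j \<in> I" "A j = {x, y}" "x \<noteq> y"
    have "(x \<in> insert v (B i)) \<noteq> (y \<in> insert v (B i))"
    proof (cases "j = i")
      case True
      then show ?thesis using leaf missed[OF i] j by auto
    next
      case False
      then have "v \<notin> A j" using leaf j by blast
      then show ?thesis using metD[OF j(1) i False j(2,3)] j by auto
    qed
    then show "(x \<in> D) = (y \<in> D)"
      using exact_coverD[OF exact_M j] union_of_componentsD[OF CV(3) j(1,2)] unfolding D_def by blast
  qed
  moreover have "D \<subseteq> C" "v \<in> D" using v unfolding D_def by auto
  ultimately have "D = C" using C unfolding component_def by blast
  then have sub: "C - M \<subseteq> insert v (B i \<inter> C)" unfolding D_def by blast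
  have "card (C - M) \<le> Suc (card (B i \<inter> C))"
    using card_mono[OF _ sub] card_insert_le_m1[of "Suc (card (B i \<inter> C))" "B i \<inter> C" v] CV by auto
  moreover have "card M \<le> card (B i - C) + card (C \<inter> M)"
  proof -
    define X where "X = (B i \<inter> V - C) \<union> (C \<inter> M)"
    have "exact_cover X"
    proof (rule exact_coverI)
      fix j x y assume j: "j \<in> I" "A j = {x, y}" "x \<noteq> y"
      have V: "x \<in> V" "y \<in> V" using j unfolding V_def by auto
      have "A i \<subseteq> C" using v leaf i CV(3) unfolding union_of_components_def by blast
      then have "x \<notin> C \<Longrightarrow> j \<noteq> i" using j by auto
      then show "(x \<in> X) \<noteq> (y \<in> X)"
        using exact_coverD[OF exact_M j] union_of_componentsD[OF CV(3) j(1,2)] metD[OF j(1) i _ j(2,3)] V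
        unfolding X_def by blast
    qed
    then have "card M \<le> card X" using M_min CV unfolding X_def by blast
    also have "\<dots> \<le> card (B i \<inter> V - C) + card (C \<inter> M)" unfolding X_def by (rule card_Un_le)
    also have "card (B i \<inter> V - C) \<le> card (B i - C)"
      using finite_B[OF i] by (intro card_mono) auto
    finally show ?thesis by simp
  qed
  moreover have "card (B i) = card (B i \<inter> C) + card (B i - C)"
    by (rule card_Int_Diff[OF finite_B[OF i]])
  ultimately show ?thesis using card_B[OF i] by simp
qed

lemma component_Int_M_nonempty:
  assumes C: "component C"
  shows "C \<inter> M \<noteq> {}"
proof -
  obtain v i where v: "v \<in> C" "i \<in> I" "v \<in> A i"
    using C unfolding component_def V_def by blast
  then have "A i \<subseteq> C" using C unfolding component_def union_of_components_def by blast
  moreover have "A i \<inter> M \<noteq> {}" using exact_M v unfolding exact_cover_def by force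
  ultimately show ?thesis by blast
qed

text \<open>
  With \<open>a = card (C \<inter> M)\<close>, \<open>b = card (C - M)\<close> and \<open>k = n - card M\<close>, the number of edges is at most
  \<open>a + b - 1 \<le> 2 * a + k \<le> a * (k + 2)\<close>, the last step because \<open>1 \<le> a\<close>.
\<close>

lemma card_edges_within_component_le:
  assumes C: "component C" and le: "card M \<le> n"
  shows "card (edges_within C) \<le> card (C \<inter> M) * (n + 2 - card M)"
proof -
  have CV: "C \<noteq> {}" "finite C"
    using C finite_V finite_subset unfolding component_def by blast+
  obtain k where k: "n = card M + k" using le le_Suc_ex by blast
  have "k \<le> card (C \<inter> M) * k"
    using component_Int_M_nonempty[OF C] CV by (simp add: Suc_leI card_gt_0_iff)
  moreover have "card (edges_within C) < card (C \<inter> M) + card (C - M)"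
    using card_edges_within_less[OF exact_M CV(2,1)] card_Int_Diff[OF CV(2)] by simp
  moreover have "card (C \<inter> M) * (n + 2 - card M) = 2 * card (C \<inter> M) + card (C \<inter> M) * k"
    unfolding k by (simp add: add_mult_distrib2)
  ultimately show ?thesis using card_component_Diff_le[OF C] k by linarith
qed

lemma edges_within_V: "edges_within V = I"
  unfolding edges_within_def V_def by auto

lemma union_of_components_V: "union_of_components V"
  unfolding union_of_components_def V_def by blast

lemma card_I_le_if_card_M_le:
  assumes le: "card M \<le> n"
  shows "card I \<le> card M * (n + 2 - card M)"
proof -
  have "card (edges_within V) \<le> card (V \<inter> M) * (n + 2 - card M)"
    using union_of_components_V order_refl
  proof (induction rule: union_of_components_induct)
    case empty
    have "edges_within {} = {}" using edge unfolding edges_within_def by force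
    then show ?case by simp
  next
    case (insert C W)
    have fin: "finite C" "finite W"
      using insert.hyps(2) finite_subset[OF _ finite_V] finite_component[OF insert.hyps(1)]
      by simp_all
    have "edges_within (C \<union> W) \<subseteq> edges_within C \<union> edges_within W"
      using insert.hyps(1,3) unfolding component_def union_of_components_def edges_within_def by blast
    then have "card (edges_within (C \<union> W)) \<le> card (edges_within C) + card (edges_within W)"
      by (meson card_Un_le card_mono finite_UnI finite_edges_within order_trans)
    also have "\<dots> \<le> (card (C \<inter> M) + card (W \<inter> M)) * (n + 2 - card M)"
      using insert.IH card_edges_within_component_le[OF insert.hyps(1) le]
      by (simp add: add_mult_distrib)
    also have "card (C \<inter> M) + card (W \<inter> M) = card ((C \<union> W) \<inter> M)"
      using card_Un_disjoint[of "C \<inter> M" "W \<inter> M"] fin insert.hyps(3)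
      by (simp add: Int_Un_distrib2 disjoint_iff)
    finally show ?case .
  qed
  then show ?thesis using M_sub by (simp add: edges_within_V Int_absorb1)
qed

text \<open>
  Now every component satisfies
  \<open>card (C - M) + card M \<le> n + 1 + card (C \<inter> M) \<le> card M + card (C \<inter> M)\<close>, so it has at most
  twice as many vertices as \<open>C \<inter> M\<close>; and \<open>card (C \<inter> M) \<le> card (C - M)\<close> yields
  \<open>card M \<le> n + 1\<close>.
\<close>

lemma card_I_le_if_less_card_M:
  assumes less: "n < card M"
  shows "card I \<le> 2 * n + 1"
proof -
  have "card V \<le> 2 * card (V \<inter> M) \<and> (V = {} \<or> card M \<le> n + 1)"
    using union_of_components_V order_refl
  proof (induction rule: union_of_components_induct)
    case (insert C W)
    have fin: "finite C" "finite W"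
      using insert.hyps(2) finite_subset[OF _ finite_V] finite_component[OF insert.hyps(1)]
      by simp_all
    have "card (C \<union> W) = card (C \<inter> M) + card (C - M) + card W"
      using card_Un_disjoint[OF fin insert.hyps(3)] card_Int_Diff[OF fin(1)] by simp
    moreover have "card ((C \<union> W) \<inter> M) = card (C \<inter> M) + card (W \<inter> M)"
      using card_Un_disjoint[of "C \<inter> M" "W \<inter> M"] fin insert.hyps(3)
      by (simp add: Int_Un_distrib2 disjoint_iff)
    ultimately show ?case
      using insert.IH card_component_Diff_le[OF insert.hyps(1)] card_component_Int_le[OF insert.hyps(1)] less
      by auto
  qed simp
  moreover have "card V = 0 \<Longrightarrow> I = {}"
    using finite_V edge unfolding V_def by fastforce
  moreover have "V \<noteq> {} \<Longrightarrow> card I < card V"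
    using card_edges_within_less[OF exact_M finite_V] edges_within_V by simp
  moreover have "card (V \<inter> M) = card M" using M_sub by (simp add: Int_absorb1)
  ultimately show ?thesis by fastforce
qed

end

theorem card_I_le: "card I \<le> max (2 * n + 1) ((n div 2 + 1) * ((n + 1) div 2 + 1))"
proof (cases "\<exists>X. exact_cover X")
  case False
  then show ?thesis using card_le_if_no_exact_cover by (simp add: le_max_iff_disj)
next
  case True
  then obtain X where X: "exact_cover X" by blast
  have "exact_cover (X \<inter> V)"
    by (rule exact_coverI) (use exact_coverD[OF X] in \<open>auto simp: V_def\<close>)
  then have "exact_cover (X \<inter> V) \<and> X \<inter> V \<subseteq> V" by simp
  then obtain M where "exact_cover M \<and> M \<subseteq> V"
      "\<forall>Y. exact_cover Y \<and> Y \<subseteq> V \<longrightarrow> card M \<le> card Y"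
    using ex_has_least_nat[of "\<lambda>Y. exact_cover Y \<and> Y \<subseteq> V" "X \<inter> V" card] by blast
  then have M: "exact_cover M" "M \<subseteq> V" "\<And>Y. exact_cover Y \<Longrightarrow> Y \<subseteq> V \<Longrightarrow> card M \<le> card Y"
    by auto
  show ?thesis
  proof (cases "card M \<le> n")
    case True
    have "card I \<le> card M * (n + 2 - card M)"
      by (rule card_I_le_if_card_M_le[of M]) (use M True in auto)
    also have "\<dots> \<le> (n div 2 + 1) * ((n + 1) div 2 + 1)"
      using True by (intro mult_le_balanced_mult) simp
    finally have "card I \<le> (n div 2 + 1) * ((n + 1) div 2 + 1)" .
    then show ?thesis by (simp add: le_max_iff_disj)
  next
    case False
    have "card I \<le> 2 * n + 1"
      by (rule card_I_le_if_less_card_M[of M]) (use M False in auto)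
    then show ?thesis by (simp add: le_max_iff_disj)
  qed
qed

end

section \<open>From set pair systems to graphs\<close>

text \<open>
  Since \<open>m\<close> is at least 2, no \<open>A i\<close> is empty.  The vertex \<open>Inr i\<close> turns a singleton into an edge
  without changing any intersection with the sets \<open>B j\<close>.
\<close>

lemma bounded_one_cross_SPS_size_le:
  fixes A B :: "nat \<Rightarrow> 'a set"
  assumes "bounded_one_cross_SPS 2 n m A B"
  shows "m \<le> max (2 * n + 1) ((n div 2 + 1) * ((n + 1) div 2 + 1))"
proof -
  note defs = bounded_one_cross_SPS_def cross_intersecting_SPS_def bounded_SPS_def
    one_cross_intersecting_def
  have m: "2 \<le> m"
    and fin: "\<And>i. i \<in> {1..m} \<Longrightarrow> finite (A i)" "\<And>i. i \<in> {1..m} \<Longrightarrow> finite (B i)"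
    and disj: "\<And>i. i \<in> {1..m} \<Longrightarrow> A i \<inter> B i = {}"
    and one: "\<And>i j. i \<in> {1..m} \<Longrightarrow> j \<in> {1..m} \<Longrightarrow> i \<noteq> j \<Longrightarrow> card (A i \<inter> B j) = 1"
    and bd: "\<And>i. i \<in> {1..m} \<Longrightarrow> card (A i) \<le> 2" "\<And>i. i \<in> {1..m} \<Longrightarrow> card (B i) \<le> n"
    using assms unfolding defs by blast+
  define A' where "A' i = Inl ` A i \<union> (if card (A i) = 1 then {Inr i} else {})" for i
  define B' :: "nat \<Rightarrow> ('a + nat) set" where "B' i = Inl ` B i" for i
  have Int: "A' i \<inter> B' j = Inl ` (A i \<inter> B j)" for i j
    unfolding A'_def B'_def by auto
  interpret edge_missing_covers "{1..m}" A' B' n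
  proof
    fix i assume i: "i \<in> {1..m}"
    define j where "j = (if i = 1 then 2 else 1::nat)"
    have "j \<in> {1..m}" "i \<noteq> j" using m unfolding j_def by auto
    then have "A i \<noteq> {}" using one[OF i] by fastforce
    then have "card (A i) = 1 \<or> card (A i) = 2"
      using bd(1)[OF i] fin(1)[OF i] by (metis card_0_eq le_antisym less_2_cases not_less One_nat_def)
    moreover have "card (Inl ` A i) = card (A i)" by (simp add: card_image)
    ultimately show "card (A' i) = 2"
      using fin(1)[OF i] unfolding A'_def by (auto simp: card_insert_if)
  next
    fix i assume "i \<in> {1..m}"
    then show "A' i \<inter> B' i = {}" unfolding Int using disj by simp
  next
    fix i j assume "i \<in> {1..m}" "j \<in> {1..m}" "i \<noteq> j"
    then show "card (A' i \<inter> B' j) = 1" unfolding Int using one by (simp add: card_image)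
  qed (use fin bd in \<open>auto simp: card_image B'_def\<close>)
  show ?thesis using card_I_le by simp
qed

section \<open>Optimal systems\<close>

text \<open>
  The graph consists of \<open>t\<close> stars with \<open>s\<close> edges each.  The centres are the numbers below \<open>t\<close>, and
  edge \<open>i\<close> joins the centre \<open>(i - 1) div s\<close> to its private leaf \<open>t + (i - 1)\<close>.  The set \<open>B i\<close>
  consists of the \<open>t - 1\<close> other centres and the \<open>s - 1\<close> other leaves of the same star.
\<close>

lemma disjoint_stars_SPS:
  assumes "2 \<le> s" "1 \<le> t"
  shows "\<exists>A B :: nat \<Rightarrow> nat set. bounded_one_cross_SPS 2 (s + t - 2) (t * s) A B"
proof -
  define A where "A i = {(i - 1) div s, t + (i - 1)}" for i
  define B where "B i = ({..<t} - {(i - 1) div s}) \<union>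
    ((+) t ` ({(i - 1) div s * s ..< (i - 1) div s * s + s} - {i - 1}))" for i
  have same_star: "j \<in> {k * s ..< k * s + s} \<longleftrightarrow> j div s = k" for j k :: nat
    using assms(1) dividend_less_times_div[of s j] by (auto simp: div_nat_eqI mult.commute)
  have centre: "(i - 1) div s < t" if "i \<in> {1..t * s}" for i
    using that assms by (intro less_mult_imp_div_less) auto
  have mem_B: "x \<in> B i \<longleftrightarrow> (if x < t then x \<noteq> (i - 1) div s
      else (x - t) div s = (i - 1) div s \<and> x - t \<noteq> i - 1)" for x i
  proof (cases "x < t")
    case False
    then obtain j where j: "x = t + j" using le_Suc_ex not_less by blast
    have "x \<in> B i \<longleftrightarrow> j \<in> {(i - 1) div s * s ..< (i - 1) div s * s + s} - {i - 1}"
      unfolding B_def j by auto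
    then show ?thesis unfolding Diff_iff same_star using j by simp
  qed (auto simp: B_def)
  have Int: "A i \<inter> B j =
      {if (i - 1) div s = (j - 1) div s then t + (i - 1) else (i - 1) div s}"
    if ij: "i \<in> {1..t * s}" "j \<in> {1..t * s}" "i \<noteq> j" for i j
  proof -
    obtain i' j' where "i = Suc i'" "j = Suc j'" using ij by (cases i; cases j) auto
    then show ?thesis using ij centre[of i] centre[of j] unfolding A_def
      by (auto simp: mem_B)
  qed
  have disj: "A i \<inter> B i = {}" if "i \<in> {1..t * s}" for i
    using centre[OF that] unfolding A_def by (auto simp: mem_B)
  have card_B: "card (B i) \<le> s + t - 2" if "i \<in> {1..t * s}" for i
  proof -
    have "card (B i) \<le> card ({..<t} - {(i - 1) div s}) +
        card ((+) t ` ({(i - 1) div s * s ..< (i - 1) div s * s + s} - {i - 1}))"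
      unfolding B_def by (rule card_Un_le)
    also have "\<dots> = (t - 1) + (s - 1)"
      using centre[OF that] same_star[of "i - 1" "(i - 1) div s"]
      by (subst card_image) (auto simp: card_Diff_singleton)
    finally show ?thesis using assms by simp
  qed
  have "2 \<le> t * s" using mult_le_mono[OF assms(2,1)] by simp
  then have "bounded_one_cross_SPS 2 (s + t - 2) (t * s) A B"
    unfolding bounded_one_cross_SPS_def cross_intersecting_SPS_def bounded_SPS_def
      one_cross_intersecting_def
    using Int disj card_B by (auto simp: A_def B_def card_insert_if)
  then show ?thesis by blast
qed

text \<open>
  Deleting the edge \<open>i\<close> from the cycle leaves a path from \<open>i + 1\<close> around to \<open>i\<close>; \<open>B i\<close> takes every
  second vertex of it, starting with the neighbour of \<open>i + 1\<close>.  The heptagon below is analogous.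
\<close>

lemma pentagon_SPS: "\<exists>A B :: nat \<Rightarrow> nat set. bounded_one_cross_SPS 2 2 5 A B"
proof -
  define A where "A i = {i mod 5, (i + 1) mod 5}" for i :: nat
  define B where "B i = {(i + 2) mod 5, (i + 4) mod 5}" for i :: nat
  have "{1..5::nat} = {1, 2, 3, 4, 5}" by auto
  then have "bounded_one_cross_SPS 2 2 5 A B"
    unfolding bounded_one_cross_SPS_def cross_intersecting_SPS_def bounded_SPS_def
      one_cross_intersecting_def A_def B_def
    by (simp add: card_insert_if)
  then show ?thesis by blast
qed

lemma heptagon_SPS: "\<exists>A B :: nat \<Rightarrow> nat set. bounded_one_cross_SPS 2 3 7 A B"
proof -
  define A where "A i = {i mod 7, (i + 1) mod 7}" for i :: nat
  define B where "B i = {(i + 2) mod 7, (i + 4) mod 7, (i + 6) mod 7}" for i :: nat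
  have "{1..7::nat} = {1, 2, 3, 4, 5, 6, 7}" by auto
  then have "bounded_one_cross_SPS 2 3 7 A B"
    unfolding bounded_one_cross_SPS_def cross_intersecting_SPS_def bounded_SPS_def
      one_cross_intersecting_def A_def B_def
    by (simp add: card_insert_if)
  then show ?thesis by blast
qed

lemma floor_half: "\<lfloor>real n / 2\<rfloor> = int (n div 2)"
  using floor_divide_of_nat_eq[of n 2] by simp

lemma ceiling_half: "\<lceil>real n / 2\<rceil> = int ((n + 1) div 2)"
proof -
  have "real ((n + 1) div 2) - 1 < real n / 2" "real n / 2 \<le> real ((n + 1) div 2)" by linarith+
  then show ?thesis by (intro ceiling_unique) auto
qed

theorem theorem1p4:
  shows
    "(\<forall>n::nat. n \<ge> 4 \<longrightarrow>
        (\<forall>m (A :: nat \<Rightarrow> 'a set) B. bounded_one_cross_SPS 2 n m A B \<longrightarrow>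
           int m \<le> (\<lfloor>real n / 2\<rfloor> + 1) * (\<lceil>real n / 2\<rceil> + 1)) \<and>
        (\<exists>m (A :: nat \<Rightarrow> nat set) B. bounded_one_cross_SPS 2 n m A B \<and>
           int m = (\<lfloor>real n / 2\<rfloor> + 1) * (\<lceil>real n / 2\<rceil> + 1))) \<and>
     ((\<forall>m (A :: nat \<Rightarrow> 'a set) B. bounded_one_cross_SPS 2 2 m A B \<longrightarrow> m \<le> 5) \<and>
      (\<exists>(A :: nat \<Rightarrow> nat set) B. bounded_one_cross_SPS 2 2 5 A B)) \<and>
     ((\<forall>m (A :: nat \<Rightarrow> 'a set) B. bounded_one_cross_SPS 2 3 m A B \<longrightarrow> m \<le> 7) \<and>
      (\<exists>(A :: nat \<Rightarrow> nat set) B. bounded_one_cross_SPS 2 3 7 A B))"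
proof -
  have floor_ceiling: "(\<lfloor>real n / 2\<rfloor> + 1) * (\<lceil>real n / 2\<rceil> + 1) =
      int ((n div 2 + 1) * ((n + 1) div 2 + 1))" for n
    unfolding floor_half ceiling_half of_nat_mult of_nat_add of_nat_1 by (rule refl)
  have upper: "m \<le> (n div 2 + 1) * ((n + 1) div 2 + 1)"
    if "4 \<le> n" "bounded_one_cross_SPS 2 n m A B" for n m and A B :: "nat \<Rightarrow> 'a set"
    using bounded_one_cross_SPS_size_le[OF that(2)] odd_cycle_le_stars[OF that(1)] by simp
  have attained: "\<exists>A B :: nat \<Rightarrow> nat set.
      bounded_one_cross_SPS 2 n ((n div 2 + 1) * ((n + 1) div 2 + 1)) A B" if "4 \<le> n" for n
  proof -
    have "(n + 1) div 2 + 1 + (n div 2 + 1) - 2 = n" by linarith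
    with disjoint_stars_SPS[of "(n + 1) div 2 + 1" "n div 2 + 1"] that show ?thesis by simp
  qed
  have small: "m \<le> 5" if "bounded_one_cross_SPS 2 2 m A B" for m and A B :: "nat \<Rightarrow> 'a set"
    using bounded_one_cross_SPS_size_le[OF that] by simp
  have small': "m \<le> 7" if "bounded_one_cross_SPS 2 3 m A B" for m and A B :: "nat \<Rightarrow> 'a set"
    using bounded_one_cross_SPS_size_le[OF that] by simp
  show ?thesis
    unfolding floor_ceiling of_nat_le_iff of_nat_eq_iff
    using upper attained small small' pentagon_SPS heptagon_SPS by blast
qed

end
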